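(* Let $M$ be a Riemannian manifold of dimension $n+p$, and let $\mathcal{F}$ and $\mathcal{F}^{\bot}$ be two orthogonal smooth foliations of complementary dimensions on $M$, with $\mathcal{F}$ of codimension $p$ and $\mathcal{F}^{\bot}$ of codimension $n$. Let $\{e_1,\ldots,e_n,e_{n+1},\ldots,e_{n+p}\}$ be an orthonormal adapted frame on an open subset of $M$. Then for every $\alpha\in\{n+1,\ldots,n+p\}$, on that open subset, $$e_{\alpha}\langle h,e_{\alpha}\rangle-\left\|H_{\mathcal{F}}^{\alpha}\right\|^2-\mathrm{Tr}(K^{\alpha}_{ij})=\sum_{i=1}^{n}H_{\mathcal{F}^{\bot}}^{i}\left(e_{\alpha},\nabla^{\bot}_{e_{i}}e_{\alpha}-[e_{\alpha},e_{i}]^{\bot}\right)-\mathrm{div}_{\mathcal{F}}(\nabla_{e_{\alpha}}e_{\alpha}).$$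
   Context: Indices: $1\le i,j\le n$ and $n+1\le\alpha,\beta\le n+p$. $\langle\cdot,\cdot\rangle$ is the metric and $\nabla$ the Levi-Civita connection. The foliations are $C^\infty$ and orthogonal, i.e. $TM=T\mathcal{F}\oplus T\mathcal{F}^{\bot}$ orthogonally. An orthonormal adapted frame is a smooth local orthonormal frame with $e_1,\ldots,e_n$ tangent to $\mathcal{F}$ and $e_{n+1},\ldots,e_{n+p}$ tangent to $\mathcal{F}^{\bot}$. For a vector field $X$: $X^{\bot}=\sum_{\alpha}\langle X,e_{\alpha}\rangle e_{\alpha}$, $X^{\top}=\sum_i\langle X,e_i\rangle e_i$, and $\nabla^{\bot}_{X}Y=(\nabla_XY)^{\bot}$. Second fundamental forms: $H_{\mathcal{F}}^{\alpha}(e_i,e_j)=\langle-\nabla_{e_i}e_{\alpha},e_j\rangle$ and $H_{\mathcal{F}^{\bot}}^{i}(e_{\alpha},e_{\beta})=\langle-\nabla_{e_{\alpha}}e_i,e_{\beta}\rangle$ (extended bilinearly). Norm: $\|H_{\mathcal{F}}^{\alpha}\|^2=\sum_{i,j}\langle-\nabla_{e_i}e_{\alpha},e_j\rangle^2$. Mean curvature vector of $\mathcal{F}$ (not normalized): $h=\sum_i(\nabla_{e_i}e_i)^{\bot}$. Curvature: $R(e_{\alpha},e_i,e_i,e_{\alpha})=\langle\nabla_{e_{\alpha}}\nabla_{e_i}e_i-\nabla_{e_i}\nabla_{e_{\alpha}}e_i-\nabla_{[e_{\alpha},e_i]}e_i,e_{\alpha}\rangle$ (the sectional curvature of the plane spanned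 by $e_\alpha,e_i$). For fixed $\alpha$, $(K^{\alpha}_{ij})$ is the $n\times n$ matrix with entries $R(e_{\alpha},e_i,e_j,e_{\alpha})$, so $\mathrm{Tr}(K^{\alpha}_{ij})=\sum_iR(e_{\alpha},e_i,e_i,e_{\alpha})$. For a smooth vector field $X$: $\mathrm{div}_{\mathcal{F}}(X)=\sum_i\langle e_i,\nabla_{e_i}X\rangle$. The expression $e_\alpha\langle h,e_\alpha\rangle$ is the derivative of the function $\langle h,e_{\alpha}\rangle$ in the direction $e_{\alpha}$. *)

theory Defs
  imports "HOL-Analysis.Analysis"
begin

section \<open>Smooth maps between Euclidean spaces\<close>

text \<open>These predicates are meant for open \<open>S\<close>: derivatives are taken at points of \<open>S\<close> in the
  full space.\<close>

primrec Ck_on :: "nat \<Rightarrow> 'b::euclidean_space set \<Rightarrow> ('b \<Rightarrow> 'c::euclidean_space) \<Rightarrow> bool" where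
  "Ck_on 0 S f \<longleftrightarrow> continuous_on S f"
| "Ck_on (Suc k) S f \<longleftrightarrow>
     (\<forall>x\<in>S. f differentiable (at x)) \<and>
     (\<forall>v. Ck_on k S (\<lambda>x. frechet_derivative f (at x) v))"

definition smooth_on :: "'b::euclidean_space set \<Rightarrow> ('b \<Rightarrow> 'c::euclidean_space) \<Rightarrow> bool" where
  "smooth_on S f \<longleftrightarrow> (\<forall>k. Ck_on k S f)"


section \<open>Smooth manifolds\<close>

text \<open>A manifold is a topology \<open>M\<close> with an atlas \<open>A\<close> modelled on the Euclidean space \<open>'e\<close>, so its
  dimension is \<open>DIM('e)\<close>. A chart is a pair of its domain and its coordinate map.\<close>

type_synonym ('a, 'e) chart = "'a set \<times> ('a \<Rightarrow> 'e)"

definition is_chart :: "'a topology \<Rightarrow> ('a, 'e::euclidean_space) chart \<Rightarrow> bool" where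
  "is_chart M = (\<lambda>(U, \<phi>). openin M U \<and> open (\<phi> ` U) \<and>
     homeomorphic_map (subtopology M U) (top_of_set (\<phi> ` U)) \<phi>)"

definition smooth_transition ::
    "('a, 'e::euclidean_space) chart \<Rightarrow> ('a, 'e) chart \<Rightarrow> bool" where
  "smooth_transition = (\<lambda>(U, \<phi>) (V, \<psi>). smooth_on (\<phi> ` (U \<inter> V)) (\<psi> \<circ> inv_into U \<phi>))"

definition smooth_manifold ::
    "'a topology \<Rightarrow> ('a, 'e::euclidean_space) chart set \<Rightarrow> bool" where
  "smooth_manifold M A \<longleftrightarrow>
     Hausdorff_space M \<and> second_countable M \<and>
     (\<forall>c\<in>A. is_chart M c) \<and> (\<Union>c\<in>A. fst c) = topspace M \<and>
     (\<forall>c\<in>A. \<forall>d\<in>A. smooth_transition c d)"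

definition maximal_atlas ::
    "'a topology \<Rightarrow> ('a, 'e::euclidean_space) chart set \<Rightarrow> ('a, 'e) chart set" where
  "maximal_atlas M A =
     {c. is_chart M c \<and> (\<forall>d\<in>A. smooth_transition c d \<and> smooth_transition d c)}"

definition smooth_fun ::
    "'a topology \<Rightarrow> ('a, 'e::euclidean_space) chart set \<Rightarrow> 'a set \<Rightarrow> ('a \<Rightarrow> real) \<Rightarrow> bool" where
  "smooth_fun M A U f \<longleftrightarrow>
     openin M U \<and> (\<forall>(V, \<phi>)\<in>A. smooth_on (\<phi> ` (U \<inter> V)) (f \<circ> inv_into V \<phi>))"

definition smooth_near ::
    "'a topology \<Rightarrow> ('a, 'e::euclidean_space) chart set \<Rightarrow> 'a \<Rightarrow> ('a \<Rightarrow> real) \<Rightarrow> bool" where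
  "smooth_near M A x f \<longleftrightarrow> (\<exists>U. x \<in> U \<and> smooth_fun M A U f)"


section \<open>Tangent vectors and vector fields\<close>

text \<open>Tangent vectors at \<open>x\<close> are the derivations of the algebra of germs at \<open>x\<close> of smooth
  functions. A derivation is represented by its values on all functions that are smooth near \<open>x\<close>;
  it is \<open>0\<close> on the remaining functions, so that equality of tangent vectors is equality of
  functionals, and sums and multiples of tangent vectors are the pointwise ones.\<close>

type_synonym 'a tvec = "('a \<Rightarrow> real) \<Rightarrow> real"
type_synonym 'a vfield = "'a \<Rightarrow> 'a tvec"

definition tangent_space ::
    "'a topology \<Rightarrow> ('a, 'e::euclidean_space) chart set \<Rightarrow> 'a \<Rightarrow> 'a tvec set" where
  "tangent_space M A x = {v.
     (\<forall>f g. smooth_near M A x f \<and> smooth_near M A x g \<longrightarrow>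
        v (\<lambda>y. f y + g y) = v f + v g \<and>
        v (\<lambda>y. f y * g y) = v f * g x + f x * v g) \<and>
     (\<forall>c f. smooth_near M A x f \<longrightarrow> v (\<lambda>y. c * f y) = c * v f) \<and>
     (\<forall>f g U. smooth_near M A x f \<and> openin M U \<and> x \<in> U \<and> (\<forall>y\<in>U. f y = g y) \<longrightarrow> v f = v g) \<and>
     (\<forall>f. \<not> smooth_near M A x f \<longrightarrow> v f = 0)}"

text \<open>A vector field is a total function, but only its values on \<open>U\<close> are constrained.\<close>

definition vfield_on ::
    "'a topology \<Rightarrow> ('a, 'e::euclidean_space) chart set \<Rightarrow> 'a set \<Rightarrow> 'a vfield \<Rightarrow> bool" where
  "vfield_on M A U X \<longleftrightarrow>
     openin M U \<and> (\<forall>x\<in>U. X x \<in> tangent_space M A x) \<and>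
     (\<forall>V f. V \<subseteq> U \<and> smooth_fun M A V f \<longrightarrow> smooth_fun M A V (\<lambda>x. X x f))"

definition lie_bracket ::
    "'a topology \<Rightarrow> ('a, 'e::euclidean_space) chart set \<Rightarrow> 'a vfield \<Rightarrow> 'a vfield \<Rightarrow> 'a vfield" where
  "lie_bracket M A X Y = (\<lambda>x f.
     if smooth_near M A x f then X x (\<lambda>y. Y y f) - Y x (\<lambda>y. X y f) else 0)"


section \<open>Riemannian metrics and the Levi-Civita connection\<close>

type_synonym 'a metric = "'a \<Rightarrow> 'a tvec \<Rightarrow> 'a tvec \<Rightarrow> real"

definition riemannian_metric ::
    "'a topology \<Rightarrow> ('a, 'e::euclidean_space) chart set \<Rightarrow> 'a metric \<Rightarrow> bool" where
  "riemannian_metric M A g \<longleftrightarrow>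
     (\<forall>x\<in>topspace M. \<forall>u\<in>tangent_space M A x. \<forall>v\<in>tangent_space M A x.
        g x u v = g x v u \<and>
        (\<forall>w\<in>tangent_space M A x. g x (\<lambda>f. u f + v f) w = g x u w + g x v w) \<and>
        (\<forall>c. g x (\<lambda>f. c * u f) v = c * g x u v) \<and>
        (u \<noteq> (\<lambda>f. 0) \<longrightarrow> g x u u > 0)) \<and>
     (\<forall>U X Y. vfield_on M A U X \<and> vfield_on M A U Y \<longrightarrow>
        smooth_fun M A U (\<lambda>x. g x (X x) (Y x)))"

definition riemannian_manifold ::
    "'a topology \<Rightarrow> ('a, 'e::euclidean_space) chart set \<Rightarrow> 'a metric \<Rightarrow> bool" where
  "riemannian_manifold M A g \<longleftrightarrow> smooth_manifold M A \<and> riemannian_metric M A g"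

type_synonym 'a connection = "'a vfield \<Rightarrow> 'a vfield \<Rightarrow> 'a vfield"

text \<open>A connection acts on vector fields defined on arbitrary open subsets \<open>U\<close> of \<open>M\<close>, compatibly
  with restriction: the last clause also relates a field on a large open set to any field that
  agrees with it on a smaller one.\<close>

definition affine_connection ::
    "'a topology \<Rightarrow> ('a, 'e::euclidean_space) chart set \<Rightarrow> 'a connection \<Rightarrow> bool" where
  "affine_connection M A D \<longleftrightarrow>
     (\<forall>U X Y. vfield_on M A U X \<and> vfield_on M A U Y \<longrightarrow>
        vfield_on M A U (D X Y) \<and>
        (\<forall>Z. vfield_on M A U Z \<longrightarrow> (\<forall>x\<in>U. \<forall>f.
           D (\<lambda>y f. X y f + Y y f) Z x f = D X Z x f + D Y Z x f \<and>
           D Z (\<lambda>y f. X y f + Y y f) x f = D Z X x f + D Z Y x f)) \<and>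
        (\<forall>r. smooth_fun M A U r \<longrightarrow> (\<forall>x\<in>U. \<forall>f.
           D (\<lambda>y f. r y * X y f) Y x f = r x * D X Y x f \<and>
           D X (\<lambda>y f. r y * Y y f) x f = X x r * Y x f + r x * D X Y x f)) \<and>
        (\<forall>X' Y'. (\<forall>x\<in>U. X' x = X x \<and> Y' x = Y x) \<longrightarrow> (\<forall>x\<in>U. D X' Y' x = D X Y x)))"

definition torsion_free ::
    "'a topology \<Rightarrow> ('a, 'e::euclidean_space) chart set \<Rightarrow> 'a connection \<Rightarrow> bool" where
  "torsion_free M A D \<longleftrightarrow>
     (\<forall>U X Y. vfield_on M A U X \<and> vfield_on M A U Y \<longrightarrow>
        (\<forall>x\<in>U. \<forall>f. D X Y x f - D Y X x f = lie_bracket M A X Y x f))"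

definition metric_compatible ::
    "'a topology \<Rightarrow> ('a, 'e::euclidean_space) chart set \<Rightarrow> 'a metric \<Rightarrow> 'a connection \<Rightarrow> bool" where
  "metric_compatible M A g D \<longleftrightarrow>
     (\<forall>U X Y Z. vfield_on M A U X \<and> vfield_on M A U Y \<and> vfield_on M A U Z \<longrightarrow>
        (\<forall>x\<in>U. X x (\<lambda>y. g y (Y y) (Z y)) = g x (D X Y x) (Z x) + g x (Y x) (D X Z x)))"

definition levi_civita ::
    "'a topology \<Rightarrow> ('a, 'e::euclidean_space) chart set \<Rightarrow> 'a metric \<Rightarrow> 'a connection \<Rightarrow> bool" where
  "levi_civita M A g D \<longleftrightarrow>
     affine_connection M A D \<and> torsion_free M A D \<and> metric_compatible M A g D"

definition curvature ::
    "'a topology \<Rightarrow> ('a, 'e::euclidean_space) chart set \<Rightarrow> 'a metric \<Rightarrow> 'a connection \<Rightarrow>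
      'a vfield \<Rightarrow> 'a vfield \<Rightarrow> 'a vfield \<Rightarrow> 'a vfield \<Rightarrow> 'a \<Rightarrow> real" where
  "curvature M A g D X Y Z W x =
     g x (\<lambda>f. D X (D Y Z) x f - D Y (D X Z) x f - D (lie_bracket M A X Y) Z x f) (W x)"


section \<open>Foliations\<close>

text \<open>A smooth foliation of codimension \<open>q\<close> is given by a foliated atlas \<open>F\<close> inside the smooth
  structure. The model space \<open>'e\<close> is sliced by the translates of a fixed subspace \<open>L\<close> of
  codimension \<open>q\<close>, which plays the role of \<open>\<real>\<^sup>n \<times> {0}\<close> in \<open>\<real>\<^sup>n \<times> \<real>\<^sup>q\<close>: locally, points on a common
  slice in one chart lie on a common slice in any other, i.e. transition maps have the form
  \<open>(x, y) \<mapsto> (h\<^sub>1 (x, y), h\<^sub>2 y)\<close>.\<close>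

definition foliation ::
    "'a topology \<Rightarrow> ('a, 'e::euclidean_space) chart set \<Rightarrow> nat \<Rightarrow>
      'e set \<Rightarrow> ('a, 'e) chart set \<Rightarrow> bool" where
  "foliation M A q L F \<longleftrightarrow>
     subspace L \<and> dim L + q = DIM('e) \<and>
     F \<subseteq> maximal_atlas M A \<and> (\<Union>c\<in>F. fst c) = topspace M \<and>
     (\<forall>(U, \<phi>)\<in>F. \<forall>(V, \<psi>)\<in>F. \<forall>x\<in>U \<inter> V.
        \<exists>W. openin M W \<and> x \<in> W \<and> W \<subseteq> U \<inter> V \<and>
            (\<forall>y\<in>W. \<forall>z\<in>W. \<phi> y - \<phi> z \<in> L \<longrightarrow> \<psi> y - \<psi> z \<in> L))"

definition chart_differential :: "('a \<Rightarrow> 'e::euclidean_space) \<Rightarrow> 'a tvec \<Rightarrow> 'e" where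
  "chart_differential \<phi> v = (\<Sum>b\<in>Basis. v (\<lambda>y. \<phi> y \<bullet> b) *\<^sub>R b)"

text \<open>The tangent space at \<open>x\<close> of the leaf through \<open>x\<close>.\<close>

definition leaf_tangent_space ::
    "'a topology \<Rightarrow> ('a, 'e::euclidean_space) chart set \<Rightarrow> 'e set \<Rightarrow> ('a, 'e) chart set \<Rightarrow>
      'a \<Rightarrow> 'a tvec set" where
  "leaf_tangent_space M A L F x =
     {v \<in> tangent_space M A x. \<forall>(U, \<phi>)\<in>F. x \<in> U \<longrightarrow> chart_differential \<phi> v \<in> L}"

definition orthogonal_foliations ::
    "'a topology \<Rightarrow> ('a, 'e::euclidean_space) chart set \<Rightarrow> 'a metric \<Rightarrow>
      'e set \<Rightarrow> ('a, 'e) chart set \<Rightarrow> 'e set \<Rightarrow> ('a, 'e) chart set \<Rightarrow> bool" where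
  "orthogonal_foliations M A g L F L' F' \<longleftrightarrow>
     (\<forall>x\<in>topspace M.
        (\<forall>u\<in>leaf_tangent_space M A L F x. \<forall>v\<in>leaf_tangent_space M A L' F' x. g x u v = 0) \<and>
        (\<forall>w\<in>tangent_space M A x.
           \<exists>u\<in>leaf_tangent_space M A L F x. \<exists>v\<in>leaf_tangent_space M A L' F' x.
             w = (\<lambda>f. u f + v f)))"

definition orthonormal_frame ::
    "'a topology \<Rightarrow> ('a, 'e::euclidean_space) chart set \<Rightarrow> 'a metric \<Rightarrow> 'a set \<Rightarrow> nat set \<Rightarrow>
      (nat \<Rightarrow> 'a vfield) \<Rightarrow> bool" where
  "orthonormal_frame M A g U I e \<longleftrightarrow>
     (\<forall>a\<in>I. vfield_on M A U (e a)) \<and>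
     (\<forall>x\<in>U. (\<forall>a\<in>I. \<forall>b\<in>I. g x (e a x) (e b x) = (if a = b then 1 else 0)) \<and>
        (\<forall>v\<in>tangent_space M A x. \<exists>c. v = (\<lambda>f. \<Sum>a\<in>I. c a * e a x f)))"

definition adapted_frame ::
    "'a topology \<Rightarrow> ('a, 'e::euclidean_space) chart set \<Rightarrow> 'a metric \<Rightarrow>
      'e set \<Rightarrow> ('a, 'e) chart set \<Rightarrow> 'e set \<Rightarrow> ('a, 'e) chart set \<Rightarrow>
      nat \<Rightarrow> nat \<Rightarrow> 'a set \<Rightarrow> (nat \<Rightarrow> 'a vfield) \<Rightarrow> bool" where
  "adapted_frame M A g L F L' F' n p U e \<longleftrightarrow>
     orthonormal_frame M A g U {1..n+p} e \<and>
     (\<forall>x\<in>U. (\<forall>i\<in>{1..n}. e i x \<in> leaf_tangent_space M A L F x) \<and>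
            (\<forall>\<alpha>\<in>{n+1..n+p}. e \<alpha> x \<in> leaf_tangent_space M A L' F' x))"


section \<open>Extrinsic geometry in an adapted frame\<close>

text \<open>Below, \<open>I\<close> is the index set of the frame fields tangent to the foliation in question:
  \<open>{1..n}\<close> for the first one, \<open>{n+1..n+p}\<close> for the second one.\<close>

definition proj :: "'a metric \<Rightarrow> (nat \<Rightarrow> 'a vfield) \<Rightarrow> nat set \<Rightarrow> 'a vfield \<Rightarrow> 'a vfield" where
  "proj g e I X = (\<lambda>x f. \<Sum>a\<in>I. g x (X x) (e a x) * e a x f)"

definition sff_coeff ::
    "'a metric \<Rightarrow> 'a connection \<Rightarrow> (nat \<Rightarrow> 'a vfield) \<Rightarrow> nat \<Rightarrow> nat \<Rightarrow> nat \<Rightarrow> 'a \<Rightarrow> real" where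
  "sff_coeff g D e k a b x = g x (\<lambda>f. - D (e a) (e k) x f) (e b x)"

definition sff ::
    "'a metric \<Rightarrow> 'a connection \<Rightarrow> (nat \<Rightarrow> 'a vfield) \<Rightarrow> nat set \<Rightarrow> nat \<Rightarrow>
      'a vfield \<Rightarrow> 'a vfield \<Rightarrow> 'a \<Rightarrow> real" where
  "sff g D e I k X Y x =
     (\<Sum>a\<in>I. \<Sum>b\<in>I. g x (X x) (e a x) * g x (Y x) (e b x) * sff_coeff g D e k a b x)"

definition sff_norm ::
    "'a metric \<Rightarrow> 'a connection \<Rightarrow> (nat \<Rightarrow> 'a vfield) \<Rightarrow> nat set \<Rightarrow> nat \<Rightarrow> 'a \<Rightarrow> real" where
  "sff_norm g D e I k x = sqrt (\<Sum>a\<in>I. \<Sum>b\<in>I. (sff_coeff g D e k a b x)\<^sup>2)"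

text \<open>The (unnormalised) mean curvature vector; \<open>J\<close> indexes the normal frame fields.\<close>

definition mean_curvature ::
    "'a metric \<Rightarrow> 'a connection \<Rightarrow> (nat \<Rightarrow> 'a vfield) \<Rightarrow> nat set \<Rightarrow> nat set \<Rightarrow> 'a vfield" where
  "mean_curvature g D e I J = (\<lambda>x f. \<Sum>i\<in>I. proj g e J (D (e i) (e i)) x f)"

definition leaf_div ::
    "'a metric \<Rightarrow> 'a connection \<Rightarrow> (nat \<Rightarrow> 'a vfield) \<Rightarrow> nat set \<Rightarrow> 'a vfield \<Rightarrow> 'a \<Rightarrow> real" where
  "leaf_div g D e I X x = (\<Sum>i\<in>I. g x (e i x) (D (e i) X x))"

definition K_matrix ::
    "'a topology \<Rightarrow> ('a, 'e::euclidean_space) chart set \<Rightarrow> 'a metric \<Rightarrow> 'a connection \<Rightarrow>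
      (nat \<Rightarrow> 'a vfield) \<Rightarrow> nat \<Rightarrow> 'a \<Rightarrow> nat \<Rightarrow> nat \<Rightarrow> real" where
  "K_matrix M A g D e \<alpha> x i j = curvature M A g D (e \<alpha>) (e i) (e j) (e \<alpha>) x"

definition index_trace :: "nat set \<Rightarrow> (nat \<Rightarrow> nat \<Rightarrow> real) \<Rightarrow> real" where
  "index_trace I K = (\<Sum>i\<in>I. K i i)"

end

theory Submission
  imports Defs
begin

text \<open>
  Write \<open>\<Gamma> a b c\<close> for \<open>\<langle>\<nabla>\<^sub>a e\<^sub>b, e\<^sub>c\<rangle>\<close> and fix a normal index \<open>\<alpha>\<close>. Metric compatibility makes \<open>\<Gamma>\<close>
  antisymmetric in its last two arguments, and torsion-freeness gives
  \<open>\<langle>[e\<^sub>a, e\<^sub>b], e\<^sub>c\<rangle> = \<Gamma> a b c - \<Gamma> b a c\<close>. The function \<open>\<langle>h, e\<^sub>\<alpha>\<rangle>\<close> is the sum of the \<open>\<Gamma> i i \<alpha>\<close> over the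
  tangent indices \<open>i\<close>, so its derivative along \<open>e\<^sub>\<alpha>\<close> involves
  \<open>\<langle>\<nabla>\<^sub>\<alpha> \<nabla>\<^sub>i e\<^sub>i, e\<^sub>\<alpha>\<rangle>\<close>, which also occurs in the curvature. The other second-order term of the
  curvature, \<open>\<langle>\<nabla>\<^sub>i \<nabla>\<^sub>\<alpha> e\<^sub>i, e\<^sub>\<alpha>\<rangle>\<close>, is traded for the summand \<open>\<langle>e\<^sub>i, \<nabla>\<^sub>i \<nabla>\<^sub>\<alpha> e\<^sub>\<alpha>\<rangle>\<close> of the divergence
  by differentiating the identity \<open>\<langle>\<nabla>\<^sub>\<alpha> e\<^sub>i, e\<^sub>\<alpha>\<rangle> + \<langle>e\<^sub>i, \<nabla>\<^sub>\<alpha> e\<^sub>\<alpha>\<rangle> = 0\<close> along \<open>e\<^sub>i\<close>. What remains for each \<open>i\<close>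
  is purely algebraic in \<open>\<Gamma>\<close> (\<open>riccati_term\<close>): the sum over all \<open>c\<close> of
  \<open>(\<Gamma> \<alpha> i c - \<Gamma> i \<alpha> c) * \<Gamma> c i \<alpha> - \<Gamma> \<alpha> i c * \<Gamma> i \<alpha> c\<close>.

  Integrability of the two foliations enters now (\<open>lie_bracket_leaf_tangent\<close>): brackets of fields
  tangent to a foliation are tangent to it, because such fields annihilate the transverse coordinates
  of a foliated chart. Hence \<open>\<Gamma> i \<alpha> j\<close> is symmetric in the tangent indices \<open>i\<close>, \<open>j\<close>, and
  \<open>\<Gamma> \<beta> i \<alpha> = \<Gamma> \<alpha> i \<beta>\<close> for normal \<open>\<beta>\<close>. The normal values of \<open>c\<close> then give exactly the second
  fundamental form of the orthogonal foliation. The tangent values give the squared norm of the second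
  fundamental form together with multiples of \<open>\<Gamma> \<alpha> i j * \<Gamma> i \<alpha> j\<close>, a product of an antisymmetric
  and a symmetric matrix, whose entries sum to zero (\<open>riccati_equation\<close>).

  These computations rest on the closure of smooth functions and vector fields under sums and
  products, and on the expansion of \<open>\<nabla>\<^sub>W Z\<close> along the frame in its direction argument
  (\<open>conn_expansion\<close>).
\<close>

section \<open>Calculus of continuously differentiable maps\<close>

lemma has_derivative_cong_open:
  assumes "open S" "x \<in> S" "\<And>y. y \<in> S \<Longrightarrow> f y = g y" "f differentiable (at x)"
  shows "(g has_derivative frechet_derivative f (at x)) (at x)"
  using assms has_derivative_transform_within_open[of f _ x UNIV S g]
  by (auto simp: frechet_derivative_works)

lemma Ck_on_cong:
  assumes "open S" "Ck_on k S f" "\<And>y. y \<in> S \<Longrightarrow> f y = g y"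
  shows "Ck_on k S g"
  using assms(2,3)
proof (induction k arbitrary: f g)
  case 0
  then show ?case by (simp cong: continuous_on_cong)
next
  case (Suc k)
  have *: "(g has_derivative frechet_derivative f (at x)) (at x)" if "x \<in> S" for x
    using has_derivative_cong_open[OF assms(1) that, of f g] Suc.prems that by auto
  have "Ck_on k S (\<lambda>x. frechet_derivative g (at x) v)" for v
    by (rule Suc.IH[of "\<lambda>x. frechet_derivative f (at x) v"])
      (use Suc.prems frechet_derivative_at[OF *] in auto)
  then show ?case using * by (auto simp: differentiable_def)
qed

lemma Ck_on_SucI:
  assumes "open S" "\<And>x. x \<in> S \<Longrightarrow> (f has_derivative f' x) (at x)"
    and "\<And>v. Ck_on k S (\<lambda>x. f' x v)"
  shows "Ck_on (Suc k) S f"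
proof -
  have "Ck_on k S (\<lambda>x. frechet_derivative f (at x) v)" for v
    by (rule Ck_on_cong[OF assms(1) assms(3)[of v]]) (simp add: frechet_derivative_at[OF assms(2)])
  then show ?thesis using assms(2) by (auto simp: differentiable_def)
qed

lemma Ck_on_Suc_has_derivative:
  assumes "Ck_on (Suc k) S f" "x \<in> S"
  shows "(f has_derivative frechet_derivative f (at x)) (at x)"
  using assms by (simp add: frechet_derivative_works)

lemma Ck_on_subset:
  assumes "Ck_on k S f" "T \<subseteq> S"
  shows "Ck_on k T f"
  using assms by (induction k arbitrary: f) (auto intro: continuous_on_subset)

lemma Ck_on_SucD:
  assumes "Ck_on (Suc k) S f"
  shows "Ck_on k S f"
  using assms
proof (induction k arbitrary: f)
  case 0
  then have "f differentiable_on S"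
    by (auto simp: differentiable_on_def intro: differentiable_at_withinI)
  then show ?case by (simp add: differentiable_imp_continuous_on)
next
  case (Suc k)
  then show ?case by (metis Ck_on.simps(2))
qed

lemma Ck_on_const: "Ck_on k S (\<lambda>x. c)"
  by (induction k arbitrary: c) auto

lemma Ck_on_add:
  assumes "open S" "Ck_on k S f" "Ck_on k S g"
  shows "Ck_on k S (\<lambda>x. f x + g x)"
  using assms(2,3)
proof (induction k arbitrary: f g)
  case 0
  then show ?case by (simp add: continuous_on_add)
next
  case (Suc k)
  show ?case
    by (rule Ck_on_SucI[OF assms(1) has_derivative_add[OF Suc.prems[THEN Ck_on_Suc_has_derivative]]])
      (use Suc in auto)
qed

lemma Ck_on_mult:
  fixes f g :: "'b::euclidean_space \<Rightarrow> real"
  assumes "open S" "Ck_on k S f" "Ck_on k S g"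
  shows "Ck_on k S (\<lambda>x. f x * g x)"
  using assms(2,3)
proof (induction k arbitrary: f g)
  case 0
  then show ?case by (simp add: continuous_on_mult)
next
  case (Suc k)
  have "Ck_on k S f" "Ck_on k S g" using Suc.prems by (auto intro: Ck_on_SucD)
  then have "Ck_on k S (\<lambda>x. f x * frechet_derivative g (at x) v + frechet_derivative f (at x) v * g x)" for v
    using Suc.prems by (intro Ck_on_add assms(1) Suc.IH) auto
  then show ?case
    by (intro Ck_on_SucI[OF assms(1) has_derivative_mult[OF Suc.prems[THEN Ck_on_Suc_has_derivative]]])
qed

lemma Ck_on_bounded_linear:
  assumes "open S" "Ck_on k S f" "bounded_linear h"
  shows "Ck_on k S (\<lambda>x. h (f x))"
  using assms(2)
proof (induction k arbitrary: f)
  case 0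
  then show ?case by (simp add: bounded_linear.continuous_on[OF assms(3)])
next
  case (Suc k)
  show ?case
    by (rule Ck_on_SucI[OF assms(1) bounded_linear.has_derivative[OF assms(3)
            Ck_on_Suc_has_derivative[OF Suc.prems]]])
      (use Suc in auto)
qed

section \<open>Smooth functions\<close>

lemma open_chart_image:
  assumes "is_chart M (V, \<phi>)" "openin M U"
  shows "open (\<phi> ` (U \<inter> V))"
proof -
  have "openin (subtopology M V) (U \<inter> V)"
    using assms(2) by (metis openin_subtopology)
  then have "openin (top_of_set (\<phi> ` V)) (\<phi> ` (U \<inter> V))"
    using assms(1) by (auto simp: is_chart_def homeomorphic_imp_open_map[unfolded open_map_def])
  then show ?thesis
    using assms(1) by (auto simp: is_chart_def intro: openin_open_trans)
qed

lemma smooth_fun_subset: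
  assumes "smooth_fun M A U f" "openin M V" "V \<subseteq> U"
  shows "smooth_fun M A V f"
proof -
  have "\<phi> ` (V \<inter> W) \<subseteq> \<phi> ` (U \<inter> W)" for \<phi> :: "'a \<Rightarrow> 'b" and W using assms(3) by auto
  then show ?thesis using assms unfolding smooth_fun_def smooth_on_def
    by (fast intro: Ck_on_subset)
qed

lemma smooth_fun_cong:
  assumes "smooth_manifold M A" "smooth_fun M A U f" "\<And>y. y \<in> U \<Longrightarrow> f y = g y"
  shows "smooth_fun M A U g"
  unfolding smooth_fun_def smooth_on_def
proof (intro conjI ballI allI, goal_cases)
  case 1
  then show ?case using assms(2) by (simp add: smooth_fun_def)
next
  case (2 c)
  obtain V \<phi> where c: "c = (V, \<phi>)" by (cases c)
  have ch: "is_chart M (V, \<phi>)" using assms(1) 2 c by (auto simp: smooth_manifold_def)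
  have o: "openin M U" using assms(2) by (simp add: smooth_fun_def)
  have "V \<subseteq> topspace M" using ch by (auto simp: is_chart_def openin_subset)
  then have inj: "inj_on \<phi> V"
    using ch homeomorphic_imp_injective_map[of "subtopology M V" "top_of_set (\<phi> ` V)" \<phi>]
    by (simp add: is_chart_def Int_absorb1)
  have "Ck_on k (\<phi> ` (U \<inter> V)) (g \<circ> inv_into V \<phi>)" for k
    by (rule Ck_on_cong[OF open_chart_image[OF ch o], of _ "f \<circ> inv_into V \<phi>"])
      (use 2 c assms inj in \<open>auto simp: smooth_fun_def smooth_on_def\<close>)
  then show ?case by (simp add: c)
qed

lemma smooth_fun_const:
  "openin M U \<Longrightarrow> smooth_fun M A U (\<lambda>x. c)"
  by (auto simp: smooth_fun_def smooth_on_def o_def Ck_on_const)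

lemma smooth_fun_add:
  assumes "smooth_manifold M A" "smooth_fun M A U f" "smooth_fun M A U g"
  shows "smooth_fun M A U (\<lambda>x. f x + g x)"
  using assms open_chart_image
  by (fastforce simp: smooth_fun_def smooth_on_def smooth_manifold_def o_def intro!: Ck_on_add)

lemma smooth_fun_mult:
  assumes "smooth_manifold M A" "smooth_fun M A U f" "smooth_fun M A U g"
  shows "smooth_fun M A U (\<lambda>x. f x * g x)"
  using assms open_chart_image
  by (fastforce simp: smooth_fun_def smooth_on_def smooth_manifold_def o_def intro!: Ck_on_mult)

lemma smooth_fun_sum:
  assumes "smooth_manifold M A" "openin M U" "\<And>k. k \<in> K \<Longrightarrow> smooth_fun M A U (f k)"
  shows "smooth_fun M A U (\<lambda>x. \<Sum>k\<in>K. f k x)"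
  using assms(3)
  by (induction K rule: infinite_finite_induct)
    (auto intro: smooth_fun_const[OF assms(2)] smooth_fun_add[OF assms(1)])

text \<open>Smoothness is tested in the charts of the given atlas; the coordinates of a foliated chart are
  smooth because that chart belongs to the maximal atlas.\<close>

lemma smooth_fun_coordinate:
  assumes "smooth_manifold M A" "(V, \<phi>) \<in> maximal_atlas M A"
  shows "smooth_fun M A V (\<lambda>y. \<phi> y \<bullet> b)"
  unfolding smooth_fun_def smooth_on_def
proof (intro conjI ballI allI, goal_cases)
  case 1
  then show ?case using assms(2) by (auto simp: maximal_atlas_def is_chart_def)
next
  case (2 c)
  obtain W \<psi> where c: "c = (W, \<psi>)" by (cases c)
  have o: "openin M V" using assms(2) by (auto simp: maximal_atlas_def is_chart_def)
  have ch: "is_chart M (W, \<psi>)" using assms(1) 2 c by (auto simp: smooth_manifold_def)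
  have "smooth_on (\<psi> ` (V \<inter> W)) (\<phi> \<circ> inv_into W \<psi>)"
    using assms(2) 2 c by (auto simp: maximal_atlas_def smooth_transition_def Int_commute)
  then show ?case unfolding c smooth_on_def
    using Ck_on_bounded_linear[OF open_chart_image[OF ch o] _ bounded_linear_inner_left[of b]]
    by (auto simp: o_def)
qed


lemma smooth_near_smooth_fun: "smooth_fun M A U f \<Longrightarrow> x \<in> U \<Longrightarrow> smooth_near M A x f"
  by (auto simp: smooth_near_def)

section \<open>Tangent vectors and vector fields\<close>

lemma tangent_space_zero: "(\<lambda>f. 0) \<in> tangent_space M A x"
  by (auto simp: tangent_space_def)

lemma tangent_space_add:
  "u \<in> tangent_space M A x \<Longrightarrow> v \<in> tangent_space M A x \<Longrightarrow> (\<lambda>f. u f + v f) \<in> tangent_space M A x"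
  unfolding tangent_space_def mem_Collect_eq by (intro conjI allI impI; simp add: algebra_simps; metis)

lemma tangent_space_scale:
  "u \<in> tangent_space M A x \<Longrightarrow> (\<lambda>f. c * u f) \<in> tangent_space M A x"
  unfolding tangent_space_def mem_Collect_eq by (intro conjI allI impI; simp add: algebra_simps; metis)

lemma tangent_space_diff:
  assumes "u \<in> tangent_space M A x" "v \<in> tangent_space M A x"
  shows "(\<lambda>f. u f - v f) \<in> tangent_space M A x"
  using tangent_space_add[OF assms(1) tangent_space_scale[OF assms(2), of "-1"]] by simp

lemma tangent_space_sum:
  assumes "\<And>k. k \<in> K \<Longrightarrow> u k \<in> tangent_space M A x"
  shows "(\<lambda>f. \<Sum>k\<in>K. u k f) \<in> tangent_space M A x"
  using assms
  by (induction K rule: infinite_finite_induct) (auto intro: tangent_space_zero tangent_space_add)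

lemma tangent_cong:
  assumes "v \<in> tangent_space M A x" "smooth_fun M A U f" "x \<in> U" "\<And>y. y \<in> U \<Longrightarrow> f y = h y"
  shows "v f = v h"
  using assms unfolding tangent_space_def mem_Collect_eq
  by (metis smooth_fun_def smooth_near_def)

lemma tangent_add:
  assumes "v \<in> tangent_space M A x" "smooth_fun M A U f" "smooth_fun M A U h" "x \<in> U"
  shows "v (\<lambda>y. f y + h y) = v f + v h"
  using assms smooth_near_smooth_fun unfolding tangent_space_def mem_Collect_eq by metis

lemma tangent_mult:
  assumes "v \<in> tangent_space M A x" "smooth_fun M A U f" "smooth_fun M A U h" "x \<in> U"
  shows "v (\<lambda>y. f y * h y) = v f * h x + f x * v h"
  using assms smooth_near_smooth_fun unfolding tangent_space_def mem_Collect_eq by metis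

lemma tangent_scale:
  assumes "v \<in> tangent_space M A x" "smooth_fun M A U f" "x \<in> U"
  shows "v (\<lambda>y. c * f y) = c * v f"
  using assms smooth_near_smooth_fun unfolding tangent_space_def mem_Collect_eq by metis

text \<open>Derivations kill constants: applying the product rule to \<open>1 * 1\<close> gives \<open>v 1 = 2 * v 1\<close>.\<close>

lemma tangent_locally_const:
  assumes "v \<in> tangent_space M A x" "openin M U" "x \<in> U" "\<And>y. y \<in> U \<Longrightarrow> f y = c"
  shows "v f = 0"
proof -
  note one = smooth_fun_const[OF assms(2), of A 1]
  have "v (\<lambda>y. 1) = 0"
    using tangent_mult[OF assms(1) one one assms(3)] by simp
  then have "v (\<lambda>y. c) = 0"
    using tangent_scale[OF assms(1) one assms(3), of c] by simp
  then show ?thesis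
    using tangent_cong[OF assms(1) smooth_fun_const[OF assms(2)] assms(3), of c f] assms(4) by simp
qed

lemma tangent_sum:
  assumes "smooth_manifold M A" "v \<in> tangent_space M A x" "openin M U" "x \<in> U"
    and "\<And>k. k \<in> K \<Longrightarrow> smooth_fun M A U (f k)"
  shows "v (\<lambda>y. \<Sum>k\<in>K. f k y) = (\<Sum>k\<in>K. v (f k))"
  using assms(5)
proof (induction K rule: infinite_finite_induct)
  case (insert k K)
  have "v (\<lambda>y. \<Sum>k\<in>insert k K. f k y) = v (\<lambda>y. f k y + (\<Sum>k\<in>K. f k y))"
    using insert by simp
  also have "\<dots> = v (f k) + v (\<lambda>y. \<Sum>k\<in>K. f k y)"
    by (rule tangent_add[OF assms(2) _ smooth_fun_sum[OF assms(1,3)] assms(4)]) (use insert in auto)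
  finally show ?case using insert by simp
qed (use tangent_locally_const[OF assms(2-4)] in auto)

lemma vfield_on_add:
  assumes "smooth_manifold M A" "vfield_on M A U X" "vfield_on M A U Y"
  shows "vfield_on M A U (\<lambda>x f. X x f + Y x f)"
  using assms by (auto simp: vfield_on_def tangent_space_add smooth_fun_add)

lemma vfield_on_scale:
  assumes "smooth_manifold M A" "smooth_fun M A U r" "vfield_on M A U X"
  shows "vfield_on M A U (\<lambda>x f. r x * X x f)"
proof -
  have "smooth_fun M A V r" if "V \<subseteq> U" "smooth_fun M A V f" for V f
    using that smooth_fun_subset[OF assms(2)] by (auto simp: smooth_fun_def)
  then show ?thesis
    using assms by (auto simp: vfield_on_def tangent_space_scale intro: smooth_fun_mult)
qed

lemma vfield_on_zero: "openin M U \<Longrightarrow> vfield_on M A U (\<lambda>x f. 0)"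
  by (auto simp: vfield_on_def tangent_space_zero smooth_fun_def smooth_on_def o_def Ck_on_const)

lemma vfield_on_sum:
  assumes "smooth_manifold M A" "openin M U" "\<And>k. k \<in> K \<Longrightarrow> vfield_on M A U (X k)"
  shows "vfield_on M A U (\<lambda>x f. \<Sum>k\<in>K. X k x f)"
  using assms(3)
  by (induction K rule: infinite_finite_induct)
    (auto intro: vfield_on_zero[OF assms(2)] vfield_on_add[OF assms(1)])

lemma vfield_on_diff:
  assumes "smooth_manifold M A" "vfield_on M A U X" "vfield_on M A U Y"
  shows "vfield_on M A U (\<lambda>x f. X x f - Y x f)"
proof -
  have "openin M U" using assms(2) by (simp add: vfield_on_def)
  from vfield_on_add[OF assms(1,2) vfield_on_scale[OF assms(1) smooth_fun_const[OF this, of A "-1"] assms(3)]]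
  show ?thesis by simp
qed

lemma vfield_on_cong:
  assumes "smooth_manifold M A" "vfield_on M A U X" "\<And>x. x \<in> U \<Longrightarrow> Y x = X x"
  shows "vfield_on M A U Y"
proof -
  have "smooth_fun M A V (\<lambda>x. Y x f)" if "V \<subseteq> U" "smooth_fun M A V f" for V f
    by (rule smooth_fun_cong[OF assms(1), of _ "\<lambda>x. X x f"])
      (use that assms(2,3) in \<open>auto simp: vfield_on_def subset_iff\<close>)
  then show ?thesis using assms(2,3) by (simp add: vfield_on_def)
qed

section \<open>Involutivity of the tangent spaces of the leaves\<close>

text \<open>The component of \<open>d\<phi> v\<close> along \<open>l\<close> is the derivative by \<open>v\<close> of the coordinate \<open>\<phi> \<bullet> l\<close>. For basis
  vectors \<open>l\<close> this is the definition; in general, expand \<open>l\<close> in the basis.\<close>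

lemma chart_differential_inner:
  assumes "smooth_manifold M A" "(V, \<phi>) \<in> maximal_atlas M A" "x \<in> V" "v \<in> tangent_space M A x"
  shows "chart_differential \<phi> v \<bullet> l = v (\<lambda>y. \<phi> y \<bullet> l)"
proof -
  note sm = smooth_fun_coordinate[OF assms(1,2)]
  have o: "openin M V" using sm by (auto simp: smooth_fun_def)
  have "v (\<lambda>y. \<phi> y \<bullet> l) = v (\<lambda>y. \<Sum>b\<in>Basis. (l \<bullet> b) * (\<phi> y \<bullet> b))"
    by (subst euclidean_inner) (simp add: mult.commute)
  also have "\<dots> = (\<Sum>b\<in>Basis. v (\<lambda>y. (l \<bullet> b) * (\<phi> y \<bullet> b)))"
    by (rule tangent_sum[OF assms(1,4) o assms(3)])
      (rule smooth_fun_mult[OF assms(1) smooth_fun_const[OF o] sm])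
  also have "\<dots> = (\<Sum>b\<in>Basis. (l \<bullet> b) * v (\<lambda>y. \<phi> y \<bullet> b))"
    using tangent_scale[OF assms(4) sm assms(3)] by simp
  finally show ?thesis
    by (simp add: chart_differential_def inner_sum_left inner_commute[of _ l] inner_sum_right mult.commute)
qed

text \<open>The elementary half of the Frobenius theorem: for \<open>l\<close> orthogonal to the model of the leaves,
  both fields annihilate the transverse coordinate \<open>\<phi> \<bullet> l\<close> near \<open>x\<close>, hence so does their bracket.
  That the bracket is a derivation at \<open>x\<close> is a hypothesis, since for a Levi-Civita connection it
  follows from torsion-freeness.\<close>

lemma lie_bracket_leaf_tangent:
  assumes "smooth_manifold M A" "foliation M A q L F" "vfield_on M A U X" "vfield_on M A U Y"
    and "\<And>y. y \<in> U \<Longrightarrow> X y \<in> leaf_tangent_space M A L F y"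
    and "\<And>y. y \<in> U \<Longrightarrow> Y y \<in> leaf_tangent_space M A L F y"
    and "x \<in> U" "lie_bracket M A X Y x \<in> tangent_space M A x"
  shows "lie_bracket M A X Y x \<in> leaf_tangent_space M A L F x"
proof -
  have "chart_differential \<phi> (lie_bracket M A X Y x) \<in> L" if c: "(V, \<phi>) \<in> F" "x \<in> V" for V \<phi>
  proof -
    have L: "subspace L" and at: "(V, \<phi>) \<in> maximal_atlas M A"
      using assms(2) c by (auto simp: foliation_def)
    have o: "openin M (U \<inter> V)"
      using at assms(3) by (auto simp: maximal_atlas_def is_chart_def vfield_on_def)
    have "chart_differential \<phi> (lie_bracket M A X Y x) \<bullet> l = 0" if l: "l \<in> orthogonal_comp L" for l
    proof -
      let ?f = "\<lambda>y. \<phi> y \<bullet> l"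
      have zero: "Z y ?f = 0"
        if "y \<in> U \<inter> V" "\<And>y. y \<in> U \<Longrightarrow> Z y \<in> leaf_tangent_space M A L F y" for Z y
      proof -
        have "Z y \<in> leaf_tangent_space M A L F y" using that by auto
        then have Z: "Z y \<in> tangent_space M A y" "chart_differential \<phi> (Z y) \<in> L"
          using that(1) c(1) by (auto simp: leaf_tangent_space_def)
        then show ?thesis
          using chart_differential_inner[OF assms(1) at _ Z(1), of l] that(1) l
          by (auto simp: orthogonal_comp_def orthogonal_def)
      qed
      have TX: "X x \<in> tangent_space M A x" and TY: "Y x \<in> tangent_space M A x"
        using assms(3,4,7) by (auto simp: vfield_on_def)
      have "X x (\<lambda>y. Y y ?f) = 0"
        by (rule tangent_locally_const[OF TX o, of _ 0]) (use zero assms(6,7) c in auto)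
      moreover have "Y x (\<lambda>y. X y ?f) = 0"
        by (rule tangent_locally_const[OF TY o, of _ 0]) (use zero assms(5,7) c in auto)
      ultimately show ?thesis
        using chart_differential_inner[OF assms(1) at c(2) assms(8)] by (simp add: lie_bracket_def)
    qed
    then have "chart_differential \<phi> (lie_bracket M A X Y x) \<in> orthogonal_comp (orthogonal_comp L)"
      by (auto simp: orthogonal_comp_def orthogonal_def inner_commute)
    then show ?thesis using orthogonal_comp_self[OF L] by simp
  qed
  then show ?thesis using assms(8) by (auto simp: leaf_tangent_space_def)
qed


section \<open>Connection coefficients of an orthonormal frame\<close>

text \<open>An orthonormal frame on an open set \<open>U\<close> of a Riemannian manifold with its Levi-Civita
  connection. No foliation is involved yet. The manifold is recorded through its smooth structure and
  metric, and everything below takes place at points of \<open>U\<close>.\<close>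

locale riemannian_frame =
  fixes M :: "'a topology" and A :: "('a, 'e::euclidean_space) chart set"
    and g :: "'a metric" and D :: "'a connection"
    and U :: "'a set" and I :: "nat set" and e :: "nat \<Rightarrow> 'a vfield"
  assumes manifold: "smooth_manifold M A"
    and metric: "riemannian_metric M A g"
    and connection: "levi_civita M A g D"
    and finite_frame: "finite I"
    and frame: "orthonormal_frame M A g U I e"
    and open_domain: "openin M U"
begin

abbreviation T :: "'a \<Rightarrow> 'a tvec set" where "T \<equiv> tangent_space M A"

text \<open>The connection coefficients \<open>\<Gamma> a b c\<close>: direction first, then the differentiated frame field,
  then the component. The third index is not raised, which is harmless in an orthonormal frame.\<close>

definition conn_coeff :: "nat \<Rightarrow> nat \<Rightarrow> nat \<Rightarrow> 'a \<Rightarrow> real" where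
  "conn_coeff a b c x = g x (D (e a) (e b) x) (e c x)"

lemma in_topspace: "x \<in> U \<Longrightarrow> x \<in> topspace M"
  using open_domain openin_subset by blast

lemma metric_sym: "x \<in> U \<Longrightarrow> u \<in> T x \<Longrightarrow> v \<in> T x \<Longrightarrow> g x u v = g x v u"
  using metric in_topspace unfolding riemannian_metric_def by blast

lemma metric_add_left:
  "x \<in> U \<Longrightarrow> u \<in> T x \<Longrightarrow> v \<in> T x \<Longrightarrow> w \<in> T x \<Longrightarrow> g x (\<lambda>f. u f + v f) w = g x u w + g x v w"
  using metric in_topspace unfolding riemannian_metric_def by blast

lemma metric_scale_left:
  "x \<in> U \<Longrightarrow> u \<in> T x \<Longrightarrow> w \<in> T x \<Longrightarrow> g x (\<lambda>f. c * u f) w = c * g x u w"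
  using metric in_topspace unfolding riemannian_metric_def by blast

lemma metric_minus_left:
  "x \<in> U \<Longrightarrow> u \<in> T x \<Longrightarrow> w \<in> T x \<Longrightarrow> g x (\<lambda>f. - u f) w = - g x u w"
  using metric_scale_left[of x u w "-1"] by simp

lemma metric_diff_left:
  assumes "x \<in> U" "u \<in> T x" "v \<in> T x" "w \<in> T x"
  shows "g x (\<lambda>f. u f - v f) w = g x u w - g x v w"
  using metric_add_left[OF assms(1,2) tangent_space_scale[OF assms(3)] assms(4), of "-1"]
    metric_scale_left[OF assms(1,3,4), of "-1"] by simp

lemma metric_sum_left:
  assumes "x \<in> U" "w \<in> T x" "\<And>k. k \<in> K \<Longrightarrow> u k \<in> T x"
  shows "g x (\<lambda>f. \<Sum>k\<in>K. u k f) w = (\<Sum>k\<in>K. g x (u k) w)"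
  using assms(3)
proof (induction K rule: infinite_finite_induct)
  case (insert k K)
  then show ?case
    using metric_add_left[OF assms(1) _ tangent_space_sum assms(2), of "u k" K u] by simp
qed (use metric_scale_left[OF assms(1) tangent_space_zero assms(2), of 0] in auto)

lemma metric_smooth: "vfield_on M A U X \<Longrightarrow> vfield_on M A U Y \<Longrightarrow> smooth_fun M A U (\<lambda>x. g x (X x) (Y x))"
  using metric unfolding riemannian_metric_def by blast

lemma vfield_tangent: "vfield_on M A U X \<Longrightarrow> x \<in> U \<Longrightarrow> X x \<in> T x"
  by (simp add: vfield_on_def)

lemma frame_vfield: "a \<in> I \<Longrightarrow> vfield_on M A U (e a)"
  using frame by (simp add: orthonormal_frame_def)

lemma frame_tangent: "a \<in> I \<Longrightarrow> x \<in> U \<Longrightarrow> e a x \<in> T x"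
  using frame_vfield vfield_tangent by blast

lemma frame_orthonormal:
  "x \<in> U \<Longrightarrow> a \<in> I \<Longrightarrow> b \<in> I \<Longrightarrow> g x (e a x) (e b x) = (if a = b then 1 else 0)"
  using frame unfolding orthonormal_frame_def by blast

lemma metric_frame_combination:
  assumes "x \<in> U" "w \<in> T x" "K \<subseteq> I"
  shows "g x (\<lambda>f. \<Sum>a\<in>K. c a * e a x f) w = (\<Sum>a\<in>K. c a * g x (e a x) w)"
proof -
  have t: "e a x \<in> T x" if "a \<in> K" for a using that assms frame_tangent by blast
  have "g x (\<lambda>f. \<Sum>a\<in>K. c a * e a x f) w = (\<Sum>a\<in>K. g x (\<lambda>f. c a * e a x f) w)"
    by (rule metric_sum_left[OF assms(1,2)]) (rule tangent_space_scale[OF t])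
  then show ?thesis using metric_scale_left[OF assms(1) t assms(2)] by simp
qed

lemma frame_expansion:
  assumes "x \<in> U" "v \<in> T x"
  shows "v = (\<lambda>f. \<Sum>a\<in>I. g x v (e a x) * e a x f)"
proof -
  obtain c where c: "v = (\<lambda>f. \<Sum>a\<in>I. c a * e a x f)"
    using frame assms unfolding orthonormal_frame_def by blast
  have "g x v (e b x) = c b" if b: "b \<in> I" for b
  proof -
    have "g x v (e b x) = (\<Sum>a\<in>I. c a * g x (e a x) (e b x))"
      unfolding c using metric_frame_combination[OF assms(1) frame_tangent[OF b assms(1)]] by simp
    also have "\<dots> = (\<Sum>a\<in>I. if a = b then c a else 0)"
      using frame_orthonormal[OF assms(1) _ b] by (intro sum.cong) auto
    finally show ?thesis using b finite_frame by simp
  qed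
  then show ?thesis by (subst c) (simp cong: sum.cong)
qed

lemma metric_frame_expansion:
  assumes "x \<in> U" "u \<in> T x" "v \<in> T x"
  shows "g x u v = (\<Sum>a\<in>I. g x u (e a x) * g x v (e a x))"
proof -
  have "g x u v = (\<Sum>a\<in>I. g x u (e a x) * g x (e a x) v)"
    by (subst frame_expansion[OF assms(1,2)]) (rule metric_frame_combination[OF assms(1,3)], simp)
  then show ?thesis using metric_sym[OF assms(1,3)] frame_tangent[OF _ assms(1)] by simp
qed

lemma metric_proj:
  assumes "x \<in> U" "K \<subseteq> I" "b \<in> K"
  shows "g x (proj g e K X x) (e b x) = g x (X x) (e b x)"
proof -
  have b: "b \<in> I" using assms by auto
  have "g x (proj g e K X x) (e b x) = (\<Sum>a\<in>K. g x (X x) (e a x) * g x (e a x) (e b x))"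
    unfolding proj_def by (rule metric_frame_combination[OF assms(1) frame_tangent[OF b assms(1)] assms(2)])
  also have "\<dots> = (\<Sum>a\<in>K. if a = b then g x (X x) (e a x) else 0)"
    using frame_orthonormal[OF assms(1) _ b] assms(2) by (intro sum.cong) auto
  finally show ?thesis using assms finite_frame by (simp add: finite_subset)
qed

lemma proj_tangent:
  assumes "x \<in> U" "K \<subseteq> I"
  shows "proj g e K X x \<in> T x"
  unfolding proj_def using assms
  by (intro tangent_space_sum tangent_space_scale frame_tangent) auto

context
  fixes X Y :: "'a vfield"
  assumes XY: "vfield_on M A U X" "vfield_on M A U Y"
begin

text \<open>The axioms of a connection, specialised to the vector fields \<open>X\<close> and \<open>Y\<close> on \<open>U\<close>.\<close>

lemmas conn_rules = connection[unfolded levi_civita_def affine_connection_def, THEN conjunct1,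
  THEN spec[of _ U], THEN spec[of _ X], THEN spec[of _ Y], THEN mp, OF conjI[OF XY]]

lemma conn_vfield: "vfield_on M A U (D X Y)"
  by (rule conjunct1[OF conn_rules])

lemma conn_add_left:
  assumes "vfield_on M A U Z" "x \<in> U"
  shows "D (\<lambda>y f. X y f + Y y f) Z x = (\<lambda>f. D X Z x f + D Y Z x f)"
  using conn_rules[THEN conjunct2, THEN conjunct1] assms by (intro ext) simp

lemma conn_scale_left:
  assumes "smooth_fun M A U r" "x \<in> U"
  shows "D (\<lambda>y f. r y * X y f) Y x = (\<lambda>f. r x * D X Y x f)"
  using conn_rules[THEN conjunct2, THEN conjunct2, THEN conjunct1] assms by (intro ext) simp

lemma conn_cong_left:
  assumes "\<And>y. y \<in> U \<Longrightarrow> X' y = X y" "x \<in> U"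
  shows "D X' Y x = D X Y x"
  using conn_rules[THEN conjunct2, THEN conjunct2, THEN conjunct2, THEN spec[of _ X'], THEN spec[of _ Y]]
    assms by simp

end

lemma conn_sum_left:
  assumes "vfield_on M A U Z" "x \<in> U" "\<And>k. k \<in> K \<Longrightarrow> vfield_on M A U (X k)"
  shows "D (\<lambda>y f. \<Sum>k\<in>K. X k y f) Z x = (\<lambda>f. \<Sum>k\<in>K. D (X k) Z x f)"
  using assms(3)
proof (induction K rule: infinite_finite_induct)
  case (insert k K)
  have K: "vfield_on M A U (\<lambda>y f. \<Sum>k\<in>K. X k y f)"
    by (rule vfield_on_sum[OF manifold open_domain]) (use insert in auto)
  show ?case using insert conn_add_left[OF _ K assms(1,2), of "X k"] by simp
qed (use conn_scale_left[OF vfield_on_zero[OF open_domain] assms(1) smooth_fun_const[OF open_domain, of _ 0] assms(2)] in auto)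

text \<open>The connection is tensorial in its direction, so only the value of \<open>W\<close> at \<open>x\<close> matters. This
  is applied to Lie brackets of frame fields in the curvature.\<close>

lemma conn_expansion:
  assumes "vfield_on M A U W" "vfield_on M A U Z" "x \<in> U" "w \<in> T x"
  shows "g x (D W Z x) w = (\<Sum>a\<in>I. g x (W x) (e a x) * g x (D (e a) Z x) w)"
proof -
  let ?r = "\<lambda>a y. g y (W y) (e a y)"
  have r: "smooth_fun M A U (?r a)" if "a \<in> I" for a
    using metric_smooth[OF assms(1) frame_vfield[OF that]] .
  have s: "vfield_on M A U (\<lambda>y f. ?r a y * e a y f)" if "a \<in> I" for a
    using vfield_on_scale[OF manifold r[OF that] frame_vfield[OF that]] .
  have "D W Z x = D (\<lambda>y f. \<Sum>a\<in>I. ?r a y * e a y f) Z x"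
    by (rule conn_cong_left[OF vfield_on_sum[OF manifold open_domain s] assms(2) _ assms(3)])
      (use frame_expansion vfield_tangent[OF assms(1)] in auto)
  also have "\<dots> = (\<lambda>f. \<Sum>a\<in>I. D (\<lambda>y f. ?r a y * e a y f) Z x f)"
    by (rule conn_sum_left[OF assms(2,3) s])
  also have "\<dots> = (\<lambda>f. \<Sum>a\<in>I. ?r a x * D (e a) Z x f)"
    using conn_scale_left[OF frame_vfield assms(2) r assms(3)] by simp
  finally have *: "D W Z x = (\<lambda>f. \<Sum>a\<in>I. ?r a x * D (e a) Z x f)" .
  have t: "D (e a) Z x \<in> T x" if "a \<in> I" for a
    using vfield_tangent[OF conn_vfield[OF frame_vfield[OF that] assms(2)] assms(3)] .
  have "g x (D W Z x) w = (\<Sum>a\<in>I. g x (\<lambda>f. ?r a x * D (e a) Z x f) w)"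
    unfolding * by (rule metric_sum_left[OF assms(3,4)]) (rule tangent_space_scale[OF t])
  then show ?thesis using metric_scale_left[OF assms(3) t assms(4)] by simp
qed

lemma lie_bracket_eq:
  "vfield_on M A U X \<Longrightarrow> vfield_on M A U Y \<Longrightarrow> x \<in> U \<Longrightarrow>
    lie_bracket M A X Y x = (\<lambda>f. D X Y x f - D Y X x f)"
  using connection unfolding levi_civita_def torsion_free_def by (intro ext) metis

text \<open>Torsion-freeness exhibits the bracket as a difference of two vector fields, so neither the
  Leibniz rule nor the smoothness of the bracket needs a separate computation.\<close>

lemma lie_bracket_vfield:
  assumes "vfield_on M A U X" "vfield_on M A U Y"
  shows "vfield_on M A U (lie_bracket M A X Y)"
  by (rule vfield_on_cong[OF manifold vfield_on_diff[OF manifold conn_vfield conn_vfield]])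
    (use assms lie_bracket_eq[OF assms] in auto)

lemma metric_derivative:
  "vfield_on M A U X \<Longrightarrow> vfield_on M A U Y \<Longrightarrow> vfield_on M A U Z \<Longrightarrow> x \<in> U \<Longrightarrow>
    X x (\<lambda>y. g y (Y y) (Z y)) = g x (D X Y x) (Z x) + g x (Y x) (D X Z x)"
  using connection unfolding levi_civita_def metric_compatible_def by blast

lemma lie_bracket_coeff:
  assumes "a \<in> I" "b \<in> I" "c \<in> I" "x \<in> U"
  shows "g x (lie_bracket M A (e a) (e b) x) (e c x) = conn_coeff a b c x - conn_coeff b a c x"
  unfolding lie_bracket_eq[OF frame_vfield[OF assms(1)] frame_vfield[OF assms(2)] assms(4)] conn_coeff_def
  using assms
  by (intro metric_diff_left vfield_tangent conn_vfield frame_vfield frame_tangent)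

text \<open>The direction is an arbitrary vector field \<open>X\<close>, so that the identity holds as one of functions
  on \<open>U\<close> and can be differentiated.\<close>

lemma conn_coeff_antisym_field:
  assumes "vfield_on M A U X" "b \<in> I" "c \<in> I" "x \<in> U"
  shows "g x (D X (e b) x) (e c x) + g x (e b x) (D X (e c) x) = 0"
proof -
  have "X x (\<lambda>y. g y (e b y) (e c y)) = 0"
    by (rule tangent_locally_const[OF vfield_tangent[OF assms(1,4)] open_domain assms(4)
          frame_orthonormal[OF _ assms(2,3)]])
  then show ?thesis
    using metric_derivative[OF assms(1) frame_vfield frame_vfield assms(4)] assms(2,3) by simp
qed

lemma conn_coeff_antisym:
  assumes "a \<in> I" "b \<in> I" "c \<in> I" "x \<in> U"
  shows "conn_coeff a b c x = - conn_coeff a c b x"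
  using conn_coeff_antisym_field[OF frame_vfield[OF assms(1)] assms(2-4)]
    metric_sym[OF assms(4) frame_tangent[OF assms(2,4)]
      vfield_tangent[OF conn_vfield[OF frame_vfield[OF assms(1)] frame_vfield[OF assms(3)]] assms(4)]]
  by (simp add: conn_coeff_def)

lemma curvature_frame:
  assumes "a \<in> I" "i \<in> I" "x \<in> U"
  shows "curvature M A g D (e a) (e i) (e i) (e a) x
    = g x (D (e a) (D (e i) (e i)) x) (e a x) - g x (D (e i) (D (e a) (e i)) x) (e a x)
      - (\<Sum>c\<in>I. (conn_coeff a i c x - conn_coeff i a c x) * conn_coeff c i a x)"
proof -
  note vf = frame_vfield[OF assms(1)] frame_vfield[OF assms(2)]
  note t = vfield_tangent[OF conn_vfield assms(3)]
  note ex = conn_expansion[OF lie_bracket_vfield[OF vf] vf(2) assms(3) frame_tangent[OF assms(1,3)]]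
  have "g x (D (lie_bracket M A (e a) (e i)) (e i) x) (e a x)
     = (\<Sum>c\<in>I. (conn_coeff a i c x - conn_coeff i a c x) * conn_coeff c i a x)"
    unfolding ex using lie_bracket_coeff[OF assms(1,2) _ assms(3)] by (simp add: conn_coeff_def)
  moreover have "curvature M A g D (e a) (e i) (e i) (e a) x
    = g x (D (e a) (D (e i) (e i)) x) (e a x) - g x (D (e i) (D (e a) (e i)) x) (e a x)
      - g x (D (lie_bracket M A (e a) (e i)) (e i) x) (e a x)"
    unfolding curvature_def
    by (simp add: metric_diff_left assms vf t tangent_space_diff conn_vfield lie_bracket_vfield frame_tangent)
  ultimately show ?thesis by simp
qed

text \<open>The contribution of one tangent index \<open>i\<close>. All second derivatives of the frame cancel, and the
  right-hand side is quadratic in the connection coefficients. No integrability is used here.\<close>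

lemma riccati_term:
  assumes "a \<in> I" "i \<in> I" "x \<in> U"
  shows "e a x (\<lambda>y. conn_coeff i i a y) - curvature M A g D (e a) (e i) (e i) (e a) x
      + g x (e i x) (D (e i) (D (e a) (e a)) x)
    = (\<Sum>c\<in>I. (conn_coeff a i c x - conn_coeff i a c x) * conn_coeff c i a x)
      - (\<Sum>c\<in>I. conn_coeff a i c x * conn_coeff i a c x)"
proof -
  note vf = frame_vfield[OF assms(1)] frame_vfield[OF assms(2)]
  note cv = conn_vfield[OF vf(1) vf(1)] conn_vfield[OF vf(1) vf(2)]
    conn_vfield[OF vf(2) vf(1)] conn_vfield[OF vf(2) vf(2)]
  have 1: "e a x (\<lambda>y. conn_coeff i i a y)
      = g x (D (e a) (D (e i) (e i)) x) (e a x) + g x (D (e i) (e i) x) (D (e a) (e a) x)"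
    unfolding conn_coeff_def by (rule metric_derivative[OF vf(1) cv(4) vf(1) assms(3)])
  let ?p = "\<lambda>y. g y (D (e a) (e i) y) (e a y)" and ?q = "\<lambda>y. g y (e i y) (D (e a) (e a) y)"
  \<comment> \<open>The derivative of \<open>\<langle>e\<^sub>i, e\<^sub>a\<rangle>\<close> along \<open>e\<^sub>a\<close> vanishes identically; differentiate it along \<open>e\<^sub>i\<close>.\<close>
  have "e i x (\<lambda>y. ?p y + ?q y) = 0"
    by (rule tangent_locally_const[OF frame_tangent[OF assms(2,3)] open_domain assms(3)
          conn_coeff_antisym_field[OF vf(1) assms(2,1)]])
  moreover have "e i x (\<lambda>y. ?p y + ?q y) = e i x ?p + e i x ?q"
    by (rule tangent_add[OF frame_tangent[OF assms(2,3)] metric_smooth[OF cv(2) vf(1)]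
          metric_smooth[OF vf(2) cv(1)] assms(3)])
  ultimately have 2: "g x (D (e i) (D (e a) (e i)) x) (e a x) + g x (D (e a) (e i) x) (D (e i) (e a) x)
      + g x (D (e i) (e i) x) (D (e a) (e a) x) + g x (e i x) (D (e i) (D (e a) (e a)) x) = 0"
    using metric_derivative[OF vf(2) cv(2) vf(1) assms(3)]
      metric_derivative[OF vf(2) vf(2) cv(1) assms(3)] by simp
  have 3: "g x (D (e a) (e i) x) (D (e i) (e a) x) = (\<Sum>c\<in>I. conn_coeff a i c x * conn_coeff i a c x)"
    unfolding conn_coeff_def
    by (rule metric_frame_expansion[OF assms(3)]) (use cv vfield_tangent assms(3) in auto)
  show ?thesis using 1 2 3 curvature_frame[OF assms] by simp
qed

lemma mean_curvature_coeff:
  assumes "N \<subseteq> I" "J \<subseteq> I" "a \<in> J" "y \<in> U"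
  shows "g y (mean_curvature g D e N J y) (e a y) = (\<Sum>i\<in>N. conn_coeff i i a y)"
proof -
  have "a \<in> I" using assms by auto
  then have "g y (mean_curvature g D e N J y) (e a y)
      = (\<Sum>i\<in>N. g y (proj g e J (D (e i) (e i)) y) (e a y))"
    unfolding mean_curvature_def
    by (intro metric_sum_left frame_tangent proj_tangent assms)
  then show ?thesis using metric_proj[OF assms(4,2,3)] by (simp add: conn_coeff_def)
qed

lemma sff_coeff_eq:
  assumes "k \<in> I" "a \<in> I" "b \<in> I" "x \<in> U"
  shows "sff_coeff g D e k a b x = - conn_coeff a k b x"
  unfolding sff_coeff_def conn_coeff_def
  by (rule metric_minus_left[OF assms(4) vfield_tangent[OF conn_vfield] frame_tangent])
    (use assms frame_vfield in auto)

lemma sff_frame_left: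
  assumes "J \<subseteq> I" "a \<in> J" "k \<in> I" "x \<in> U"
  shows "sff g D e J k (e a) Y x = - (\<Sum>b\<in>J. g x (Y x) (e b x) * conn_coeff a k b x)"
proof -
  have fin: "finite J" using assms(1) finite_frame finite_subset by blast
  have "sff g D e J k (e a) Y x
      = (\<Sum>c\<in>J. if c = a then \<Sum>b\<in>J. g x (Y x) (e b x) * sff_coeff g D e k c b x else 0)"
    unfolding sff_def
    using frame_orthonormal[OF assms(4)] assms by (intro sum.cong) (auto simp: subset_iff)
  also have "\<dots> = (\<Sum>b\<in>J. g x (Y x) (e b x) * sff_coeff g D e k a b x)"
    using assms(2) fin by simp
  also have "\<dots> = (\<Sum>b\<in>J. - (g x (Y x) (e b x) * conn_coeff a k b x))"
    using assms by (intro sum.cong) (auto simp: sff_coeff_eq subset_iff)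
  finally show ?thesis by (simp add: sum_negf)
qed

text \<open>Since \<open>[e\<^sub>a, e\<^sub>i] = \<nabla>\<^sub>a e\<^sub>i - \<nabla>\<^sub>i e\<^sub>a\<close>, the second argument of the form is the normal part of
  \<open>2 \<nabla>\<^sub>i e\<^sub>a - \<nabla>\<^sub>a e\<^sub>i\<close>.\<close>

lemma sff_normal_term:
  assumes "J \<subseteq> I" "a \<in> J" "i \<in> I" "x \<in> U"
  shows "sff g D e J i (e a)
      (\<lambda>y f. proj g e J (D (e i) (e a)) y f - proj g e J (lie_bracket M A (e a) (e i)) y f) x
    = (\<Sum>b\<in>J. (conn_coeff a i b x - 2 * conn_coeff i a b x) * conn_coeff a i b x)"
proof -
  have coeff: "g x (\<lambda>f. proj g e J (D (e i) (e a)) x f - proj g e J (lie_bracket M A (e a) (e i)) x f) (e b x)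
      = 2 * conn_coeff i a b x - conn_coeff a i b x" if "b \<in> J" for b
  proof -
    have "b \<in> I" "a \<in> I" using that assms by auto
    then show ?thesis
      using lie_bracket_coeff[of a i b x] assms that
      by (simp add: metric_diff_left proj_tangent frame_tangent metric_proj conn_coeff_def)
  qed
  show ?thesis
    unfolding sff_frame_left[OF assms] sum_negf[symmetric]
    by (intro sum.cong) (simp_all add: coeff left_diff_distrib)
qed

end


section \<open>The Riccati equation for a pair of orthogonal foliations\<close>

lemma antisym_sym_sum_zero:
  fixes P S :: "nat \<Rightarrow> nat \<Rightarrow> real"
  assumes "\<And>i j. i \<in> N \<Longrightarrow> j \<in> N \<Longrightarrow> P i j = - P j i" "\<And>i j. i \<in> N \<Longrightarrow> j \<in> N \<Longrightarrow> S i j = S j i"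
  shows "(\<Sum>i\<in>N. \<Sum>j\<in>N. P i j * S i j) = 0"
proof -
  have "(\<Sum>i\<in>N. \<Sum>j\<in>N. P i j * S i j) = (\<Sum>i\<in>N. \<Sum>j\<in>N. P j i * S j i)"
    by (rule sum.swap)
  also have "\<dots> = (\<Sum>i\<in>N. \<Sum>j\<in>N. - (P i j * S i j))"
    using assms by (intro sum.cong refl) (metis mult_minus_left)
  finally show ?thesis by (simp add: sum_negf)
qed

context riemannian_frame
begin

text \<open>The identity for a frame split into tangent indices \<open>N\<close> and normal indices \<open>J\<close>. Of the two
  foliations only the pointwise consequences of integrability that involve the fixed normal field
  \<open>e\<^sub>a\<close> are needed.\<close>

lemma riccati_equation:
  assumes "N \<union> J = I" "N \<inter> J = {}" "a \<in> J" "x \<in> U"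
    and invN: "\<And>i j. i \<in> N \<Longrightarrow> j \<in> N \<Longrightarrow> g x (lie_bracket M A (e i) (e j) x) (e a x) = 0"
    and invJ: "\<And>b i. b \<in> J \<Longrightarrow> i \<in> N \<Longrightarrow> g x (lie_bracket M A (e a) (e b) x) (e i x) = 0"
  shows "e a x (\<lambda>y. g y (mean_curvature g D e N J y) (e a y))
           - (sff_norm g D e N a x)\<^sup>2 - index_trace N (K_matrix M A g D e a x)
         = (\<Sum>i\<in>N. sff g D e J i (e a)
              (\<lambda>y f. proj g e J (D (e i) (e a)) y f - proj g e J (lie_bracket M A (e a) (e i)) y f) x)
           - leaf_div g D e N (D (e a) (e a)) x"
proof -
  let ?G = "\<lambda>a b c. conn_coeff a b c x"
  have sub: "N \<subseteq> I" "J \<subseteq> I" "a \<in> I" using assms by auto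
  have fin: "finite N" "finite J" using sub finite_frame finite_subset by blast+
  have inI: "i \<in> N \<Longrightarrow> i \<in> I" "b \<in> J \<Longrightarrow> b \<in> I" for i b using sub by auto
  have sm: "smooth_fun M A U (conn_coeff i i a)" if "i \<in> N" for i
    using metric_smooth[OF conn_vfield[OF frame_vfield frame_vfield] frame_vfield, of i i a] that sub
    by (auto simp: conn_coeff_def[abs_def])
  have "e a x (\<lambda>y. g y (mean_curvature g D e N J y) (e a y)) = e a x (\<lambda>y. \<Sum>i\<in>N. conn_coeff i i a y)"
    by (rule tangent_cong[OF frame_tangent[OF sub(3) assms(4)] smooth_fun_sum[OF manifold open_domain sm] assms(4), symmetric])
      (use mean_curvature_coeff[OF sub(1,2) assms(3)] in auto)
  also have "\<dots> = (\<Sum>i\<in>N. e a x (conn_coeff i i a))"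
    by (rule tangent_sum[OF manifold frame_tangent[OF sub(3) assms(4)] open_domain assms(4) sm])
  finally have h: "e a x (\<lambda>y. g y (mean_curvature g D e N J y) (e a y)) = (\<Sum>i\<in>N. e a x (conn_coeff i i a))" .
  have norm: "(sff_norm g D e N a x)\<^sup>2 = (\<Sum>i\<in>N. \<Sum>j\<in>N. (?G i a j)\<^sup>2)"
    unfolding sff_norm_def using sub assms(4)
    by (simp add: sum_nonneg sff_coeff_eq subset_iff cong: sum.cong)
  \<comment> \<open>The component along \<open>e\<^sub>a\<close> of the second fundamental form of the \<open>N\<close>-leaves is symmetric.\<close>
  have symN: "?G i a j = ?G j a i" if "i \<in> N" "j \<in> N" for i j
    using invN[OF that] lie_bracket_coeff[of i j a x] conn_coeff_antisym[of i j a x]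
      conn_coeff_antisym[of j i a x] that inI sub(3) assms(4) by auto
  \<comment> \<open>The second fundamental form of the \<open>J\<close>-leaves is symmetric when one argument is \<open>e\<^sub>a\<close>.\<close>
  have symJ: "?G b i a = ?G a i b" if "i \<in> N" "b \<in> J" for i b
    using invJ[OF that(2,1)] lie_bracket_coeff[of a b i x] conn_coeff_antisym[of a i b x]
      conn_coeff_antisym[of b i a x] that inI sub(3) assms(4) by auto
  have zero: "(\<Sum>i\<in>N. \<Sum>j\<in>N. ?G a i j * ?G i a j) = 0"
    by (rule antisym_sym_sum_zero) (rule conn_coeff_antisym[OF sub(3) inI(1) inI(1) assms(4)], assumption+, rule symN)
  have summand: "e a x (conn_coeff i i a) - K_matrix M A g D e a x i i
       + g x (e i x) (D (e i) (D (e a) (e a)) x)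
      = sff g D e J i (e a)
          (\<lambda>y f. proj g e J (D (e i) (e a)) y f - proj g e J (lie_bracket M A (e a) (e i)) y f) x
        + (\<Sum>j\<in>N. (?G i a j)\<^sup>2) - 2 * (\<Sum>j\<in>N. ?G a i j * ?G i a j)" if i: "i \<in> N" for i
  proof -
    have iI: "i \<in> I" using i sub by auto
    have flip: "?G j i a = - ?G i a j" if "j \<in> N" for j
      using symN[OF i that] conn_coeff_antisym[of j i a x] that iI sub assms(4) by auto
    have "e a x (conn_coeff i i a) - K_matrix M A g D e a x i i
       + g x (e i x) (D (e i) (D (e a) (e a)) x)
      = (\<Sum>c\<in>N \<union> J. (?G a i c - ?G i a c) * ?G c i a - ?G a i c * ?G i a c)"
      using riccati_term[OF sub(3) iI assms(4)] by (simp add: K_matrix_def assms(1) sum_subtractf)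
    also have "\<dots> = (\<Sum>j\<in>N. (?G a i j - ?G i a j) * ?G j i a - ?G a i j * ?G i a j)
        + (\<Sum>b\<in>J. (?G a i b - ?G i a b) * ?G b i a - ?G a i b * ?G i a b)"
      by (rule sum.union_disjoint[OF fin assms(2)])
    also have "\<dots> = (\<Sum>j\<in>N. (?G i a j)\<^sup>2 - 2 * (?G a i j * ?G i a j))
        + (\<Sum>b\<in>J. (?G a i b - 2 * ?G i a b) * ?G a i b)"
      by (intro arg_cong2[where f="(+)"] sum.cong refl)
        (simp_all add: flip symJ[OF i] algebra_simps power2_eq_square)
    finally show ?thesis
      unfolding sff_normal_term[OF sub(2) assms(3) iI assms(4)]
      by (simp add: sum_subtractf sum_distrib_left)
  qed
  from sum.cong[OF refl summand, of N "\<lambda>i. i"] show ?thesis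
    unfolding h norm index_trace_def leaf_div_def
    using zero by (simp add: sum_subtractf sum.distrib flip: sum_distrib_left)
qed

end

theorem theorem1:
  fixes M :: "'a topology"
    and A :: "('a, 'e::euclidean_space) chart set"
    and g :: "'a metric"
    and D :: "'a connection"
    and L L' :: "'e set"
    and F F' :: "('a, 'e) chart set"
    and n p :: nat
    and U :: "'a set"
    and e :: "nat \<Rightarrow> 'a vfield"
    and \<alpha> :: nat
    and x :: 'a
  assumes "DIM('e) = n + p"
    and "riemannian_manifold M A g"
    and "levi_civita M A g D"
    and "foliation M A p L F"
    and "foliation M A n L' F'"
    and "orthogonal_foliations M A g L F L' F'"
    and "openin M U"
    and "adapted_frame M A g L F L' F' n p U e"
    and "\<alpha> \<in> {n+1..n+p}"
    and "x \<in> U"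
  defines "h \<equiv> mean_curvature g D e {1..n} {n+1..n+p}"
  shows "e \<alpha> x (\<lambda>y. g y (h y) (e \<alpha> y))
           - (sff_norm g D e {1..n} \<alpha> x)\<^sup>2
           - index_trace {1..n} (K_matrix M A g D e \<alpha> x)
         = (\<Sum>i=1..n. sff g D e {n+1..n+p} i (e \<alpha>)
              (\<lambda>y f. proj g e {n+1..n+p} (D (e i) (e \<alpha>)) y f
                   - proj g e {n+1..n+p} (lie_bracket M A (e \<alpha>) (e i)) y f) x)
           - leaf_div g D e {1..n} (D (e \<alpha>) (e \<alpha>)) x"
proof -
  interpret riemannian_frame M A g D U "{1..n+p}" e
    using assms by unfold_locales (auto simp: riemannian_manifold_def adapted_frame_def)
  have tan: "e i y \<in> leaf_tangent_space M A L F y" if "i \<in> {1..n}" "y \<in> U" for i y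
    using assms(8) that by (simp add: adapted_frame_def)
  have nor: "e b y \<in> leaf_tangent_space M A L' F' y" if "b \<in> {n+1..n+p}" "y \<in> U" for b y
    using assms(8) that unfolding adapted_frame_def by blast
  have orth: "g x u v = 0"
    if "u \<in> leaf_tangent_space M A L F x" "v \<in> leaf_tangent_space M A L' F' x" for u v
    using assms(6) that in_topspace[OF assms(10)] unfolding orthogonal_foliations_def by blast
  have lb: "lie_bracket M A (e a) (e b) x \<in> T x" if "a \<in> {1..n+p}" "b \<in> {1..n+p}" for a b
    using vfield_tangent[OF lie_bracket_vfield[OF frame_vfield frame_vfield] assms(10)] that by blast
  show ?thesis
    unfolding h_def
  proof (rule riccati_equation)
    show "{1..n} \<union> {n+1..n+p} = {1..n+p}" "{1..n} \<inter> {n+1..n+p} = {}" by auto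
    show "\<alpha> \<in> {n+1..n+p}" "x \<in> U" using assms by auto
  next
    fix i j assume ij: "i \<in> {1..n}" "j \<in> {1..n}"
    then have I: "i \<in> {1..n+p}" "j \<in> {1..n+p}" by auto
    have "lie_bracket M A (e i) (e j) x \<in> leaf_tangent_space M A L F x"
      by (rule lie_bracket_leaf_tangent[OF manifold assms(4) frame_vfield[OF I(1)] frame_vfield[OF I(2)]
            tan[OF ij(1)] tan[OF ij(2)] assms(10) lb[OF I]])
    then show "g x (lie_bracket M A (e i) (e j) x) (e \<alpha> x) = 0"
      using orth nor[OF assms(9,10)] by blast
  next
    fix b i assume b: "b \<in> {n+1..n+p}" and i: "i \<in> {1..n}"
    then have I: "\<alpha> \<in> {1..n+p}" "b \<in> {1..n+p}" "i \<in> {1..n+p}" using assms(9) by auto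
    have "lie_bracket M A (e \<alpha>) (e b) x \<in> leaf_tangent_space M A L' F' x"
      by (rule lie_bracket_leaf_tangent[OF manifold assms(5) frame_vfield[OF I(1)] frame_vfield[OF I(2)]
            nor[OF assms(9)] nor[OF b] assms(10) lb[OF I(1,2)]])
    then show "g x (lie_bracket M A (e \<alpha>) (e b) x) (e i x) = 0"
      using orth[OF tan[OF i assms(10)]] metric_sym[OF assms(10) lb[OF I(1,2)] frame_tangent[OF I(3) assms(10)]]
      by simp
  qed
qed

end
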